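(* Let $X$ be a non-negative random variable with absolutely continuous distribution function $F$ and finite mean. For the choice $w(u)=F(u)$ and $\phi(x)=2x$, the generalized cumulative entropy of $X$ equals the Gini mean difference of $X$, i.e. $\mathcal{GCE}(X)=GMD$.
   Context: The Gini mean difference is $GMD=E|X_1-X_2|$, where $X_1,X_2$ are independent random variables with distribution function $F$. For a function $\phi$ and a weight function $w$, the generalized cumulative entropy is $$\mathcal{GCE}(X)=\int_0^\infty w(u)\,E\big[\phi(u)-\phi(X)\,\big|\,X\le u\big]\,dF(u),$$ where the integrand is considered at those $u$ with $F(u)>0$ (which is $dF$-almost every $u$). *)

theory Defs
  imports "HOL-Probability.Probability"
begin

text \<open>Absolute continuity of a real function on the whole line (the library only has
  absolute continuity of one measure with respect to another).\<close>

definition abs_continuous_fun :: "(real \<Rightarrow> real) \<Rightarrow> bool" where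
  "abs_continuous_fun f \<longleftrightarrow>
     (\<forall>\<epsilon>>0. \<exists>\<delta>>0. \<forall>(n::nat) (a :: nat \<Rightarrow> real) (b :: nat \<Rightarrow> real).
        (\<forall>i<n. a i \<le> b i) \<longrightarrow>
        disjoint_family_on (\<lambda>i. {a i<..<b i}) {..<n} \<longrightarrow>
        (\<Sum>i<n. b i - a i) < \<delta> \<longrightarrow>
        (\<Sum>i<n. \<bar>f (b i) - f (a i)\<bar>) < \<epsilon>)"

definition dist_fun :: "'a measure \<Rightarrow> ('a \<Rightarrow> real) \<Rightarrow> real \<Rightarrow> real" where
  "dist_fun M X = cdf (distr M borel X)"

text \<open>The elementary conditional expectation of \<open>Y\<close> given an event \<open>A\<close>: the mean of \<open>Y\<close> under
  the conditional probability \<open>P(\<cdot> | A)\<close>. It is only meaningful when \<open>A\<close> has positive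
  probability.\<close>

definition cond_expect_event :: "'a measure \<Rightarrow> 'a set \<Rightarrow> ('a \<Rightarrow> real) \<Rightarrow> real" where
  "cond_expect_event M A Y = (LINT \<omega> | uniform_measure M A. Y \<omega>)"

text \<open>Integration against \<open>dF\<close> is integration against the Lebesgue--Stieltjes measure of \<open>F\<close>.\<close>

definition gen_cumulative_entropy ::
  "'a measure \<Rightarrow> ('a \<Rightarrow> real) \<Rightarrow> (real \<Rightarrow> real) \<Rightarrow> (real \<Rightarrow> real) \<Rightarrow> real" where
  "gen_cumulative_entropy M X w \<phi> =
     (LINT u : {u. 0 \<le> u \<and> dist_fun M X u > 0} | interval_measure (dist_fun M X).
        w u * cond_expect_event M {\<omega> \<in> space M. X \<omega> \<le> u} (\<lambda>\<omega>. \<phi> u - \<phi> (X \<omega>)))"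

end

theory Submission
  imports Defs
begin

text \<open>The weight \<open>F(u)\<close> cancels the normalisation of the conditional expectation, so the integrand
  of the entropy is \<open>2 E[(u - X)\<^sup>+]\<close>; it vanishes where \<open>u < 0\<close> or \<open>F(u) = 0\<close>, and the restricted
  domain of integration is immaterial. On the other side, \<open>\<bar>x - y\<bar> = (x - y)\<^sup>+ + (y - x)\<^sup>+\<close> and the
  symmetry of the joint law of two independent copies give \<open>GMD = 2 E[(X\<^sub>1 - X\<^sub>2)\<^sup>+]\<close>. Fubini's theorem
  identifies the two.\<close>

text \<open>A probability law on the Borel line is determined by its distribution function, and both
  sides have the same one. This turns integration against dF into integration against the law of
  \<open>X\<close>.\<close>

lemma interval_measure_cdf:
  assumes "real_distribution D"
  shows "interval_measure (cdf D) = D"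
proof -
  interpret real_distribution D by fact
  show ?thesis
    using cdf_nondecreasing cdf_is_right_cont cdf_lim_at_bot cdf_lim_at_top prob_space
    by (intro cdf_unique real_distribution_interval_measure cdf_interval_measure assms) auto
qed

text \<open>Conditioning on \<open>A\<close> divides by \<open>measure M A\<close>, and the factor
  in front undoes it. If \<open>A\<close> is null, that factor makes the left side 0 whatever the
  integral is, and the right side integrates over a null set.\<close>

lemma (in finite_measure) measure_times_integral_uniform_measure:
  fixes f :: "'a \<Rightarrow> real"
  assumes [measurable]: "A \<in> sets M" "f \<in> borel_measurable M"
  shows "measure M A * (LINT x | (uniform_measure M A). f x) = (LINT x : A | M. f x)"
proof (cases "measure M A = 0")
  case True
  then have "AE x in M. x \<notin> A"
    by (intro AE_not_in) (simp add: null_sets_def emeasure_eq_measure)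
  then have "AE x in M. indicator A x *\<^sub>R f x = 0"
    by eventually_elim simp
  then have "(LINT x : A | M. f x) = 0"
    unfolding set_lebesgue_integral_def by (rule integral_eq_zero_AE)
  then show ?thesis
    using True by simp
next
  case False
  \<comment> \<open>The density is brought to the form \<open>ennreal\<close> of a real function, so
    that \<open>integral_real_density\<close> applies.\<close>
  have "uniform_measure M A = density M (\<lambda>x. ennreal (indicator A x / measure M A))"
    using False unfolding uniform_measure_def
    by (intro density_cong)
       (auto simp: emeasure_eq_measure divide_ennreal zero_less_measure_iff split: split_indicator
             simp flip: ennreal_1)
  then show ?thesis
    using False by (simp add: integral_real_density set_lebesgue_integral_def)
qed

lemma integral_pair_abs_diff:
  fixes D :: "real measure"
  assumes "real_distribution D" and int: "integrable (D \<Otimes>\<^sub>M D) (\<lambda>(x, y). \<bar>x - y\<bar>)"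
  shows "(LINT (x, y) | (D \<Otimes>\<^sub>M D). \<bar>x - y\<bar>) = 2 * (LINT x | D. LINT y | D. max 0 (x - y))"
proof -
  interpret real_distribution D by fact
  interpret pair_sigma_finite D D ..
  \<comment> \<open>Domination by \<bar>x - y\<bar>. This integrability justifies both splitting the
    integral into two positive parts and the final use of Fubini.\<close>
  have int_max: "integrable (D \<Otimes>\<^sub>M D) (\<lambda>(x, y). max 0 (x - y))"
    by (rule Bochner_Integration.integrable_bound[OF int]) (auto simp: case_prod_beta)
  have "(LINT (x, y) | (D \<Otimes>\<^sub>M D). \<bar>x - y\<bar>) =
        (LINT z | (D \<Otimes>\<^sub>M D). (case z of (x, y) \<Rightarrow> max 0 (x - y)) + (case z of (x, y) \<Rightarrow> max 0 (y - x)))"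
    by (intro Bochner_Integration.integral_cong) auto
  also have "\<dots> = (LINT (x, y) | (D \<Otimes>\<^sub>M D). max 0 (x - y)) + (LINT (x, y) | (D \<Otimes>\<^sub>M D). max 0 (y - x))"
    using int_max integrable_product_swap[OF int_max]
    by (intro Bochner_Integration.integral_add) simp_all
  also have "(LINT (x, y) | (D \<Otimes>\<^sub>M D). max 0 (y - x)) = (LINT (x, y) | (D \<Otimes>\<^sub>M D). max 0 (x - y))"
    using integral_product_swap[of "\<lambda>(x, y). max 0 (x - y)"] int_max by simp
  finally show ?thesis
    using integral_fst[OF int_max] by simp
qed

text \<open>The identity includes the points with F(u) = 0, so it can rewrite the integrand of the
  entropy pointwise.\<close>

lemma (in prob_space) weighted_cond_expect_event:
  assumes [measurable]: "X \<in> borel_measurable M"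
  shows "dist_fun M X u *
           cond_expect_event M {\<omega> \<in> space M. X \<omega> \<le> u} (\<lambda>\<omega>. 2 * u - 2 * X \<omega>) =
         2 * (LINT x | (distr M borel X). max 0 (u - x))"
proof -
  let ?A = "{\<omega> \<in> space M. X \<omega> \<le> u}"
  have "dist_fun M X u = measure M ?A"
    by (auto simp: dist_fun_def cdf_def measure_distr intro!: arg_cong[where f = "measure M"])
  then have "dist_fun M X u * cond_expect_event M ?A (\<lambda>\<omega>. 2 * u - 2 * X \<omega>) =
             (LINT \<omega> : ?A | M. 2 * u - 2 * X \<omega>)"
    by (simp add: cond_expect_event_def measure_times_integral_uniform_measure)
  \<comment> \<open>On the event, u - X is its own positive part; off the event, that positive part
    is 0.\<close>
  also have "\<dots> = (LINT \<omega> | M. 2 * max 0 (u - X \<omega>))"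
    unfolding set_lebesgue_integral_def
    by (intro Bochner_Integration.integral_cong) (auto split: split_indicator)
  finally show ?thesis
    by (simp add: integral_distr)
qed

lemma (in prob_space) gen_cumulative_entropy_double:
  assumes X[measurable]: "X \<in> borel_measurable M" and nonneg: "AE \<omega> in M. 0 \<le> X \<omega>"
  shows "gen_cumulative_entropy M X (dist_fun M X) (\<lambda>x. 2 * x) =
         2 * (LINT u | (distr M borel X). LINT x | (distr M borel X). max 0 (u - x))"
proof -
  define D where "D = distr M borel X"
  interpret D: real_distribution D
    unfolding D_def by simp
  have Dnonneg: "AE x in D. 0 \<le> x"
    unfolding D_def using nonneg by (subst AE_distr_iff) auto
  \<comment> \<open>Outside the domain of the entropy integral, almost every x exceeds u or equals
    it: for u \<ge> 0 because \<open>{..u}\<close> is \<open>D\<close>-null, for u < 0 because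
    \<open>D\<close> lives on the non-negative reals. The domain can then be enlarged to the whole
    line.\<close>
  have vanish: "(LINT x | D. max 0 (u - x)) = 0" if "\<not> (0 \<le> u \<and> 0 < cdf D u)" for u
  proof (cases "0 \<le> u")
    case True
    then have "measure D {..u} = 0"
      using that by (simp add: cdf_def zero_less_measure_iff)
    then have "AE x in D. x \<notin> {..u}"
      by (intro AE_not_in) (simp add: null_sets_def D.emeasure_eq_measure)
    then have "AE x in D. max 0 (u - x) = 0"
      by eventually_elim auto
    then show ?thesis by (rule integral_eq_zero_AE)
  next
    case False
    from Dnonneg have "AE x in D. max 0 (u - x) = 0"
      by eventually_elim (use False in auto)
    then show ?thesis by (rule integral_eq_zero_AE)
  qed
  have F: "dist_fun M X = cdf D"
    by (simp add: dist_fun_def D_def)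
  have "gen_cumulative_entropy M X (dist_fun M X) (\<lambda>x. 2 * x) =
        (LINT u : {u. 0 \<le> u \<and> cdf D u > 0} | D. 2 * (LINT x | D. max 0 (u - x)))"
    unfolding gen_cumulative_entropy_def weighted_cond_expect_event[OF X]
    unfolding F interval_measure_cdf[OF D.real_distribution_axioms] D_def[symmetric] ..
  also have "\<dots> = (LINT u | D. 2 * (LINT x | D. max 0 (u - x)))"
    unfolding set_lebesgue_integral_def using vanish
    by (intro Bochner_Integration.integral_cong) (auto split: split_indicator)
  finally show ?thesis
    by (simp add: D_def)
qed

theorem theorem2:
  fixes M :: "'a measure" and X :: "'a \<Rightarrow> real"
    and N :: "'b measure" and X1 X2 :: "'b \<Rightarrow> real"
    and F :: "real \<Rightarrow> real"
  assumes "prob_space M" and "X \<in> borel_measurable M"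
    and "AE \<omega> in M. 0 \<le> X \<omega>"
    and "F = dist_fun M X"
    and "abs_continuous_fun F"
    and "integrable M X"
    and "prob_space N" and "prob_space.indep_var N borel X1 borel X2"
    and "dist_fun N X1 = F" and "dist_fun N X2 = F"
  shows "gen_cumulative_entropy M X F (\<lambda>x. 2 * x) =
         prob_space.expectation N (\<lambda>\<omega>. \<bar>X1 \<omega> - X2 \<omega>\<bar>)"
proof -
  interpret M: prob_space M by fact
  interpret N: prob_space N by fact
  define D where "D = distr M borel X"
  have D: "real_distribution D"
    using assms(2) by (simp add: D_def)
  have X1[measurable]: "X1 \<in> borel_measurable N" and X2[measurable]: "X2 \<in> borel_measurable N"
    and joint: "distr N borel X1 \<Otimes>\<^sub>M distr N borel X2 =
                distr N (borel \<Otimes>\<^sub>M borel) (\<lambda>\<omega>. (X1 \<omega>, X2 \<omega>))"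
    using assms(8) by (auto simp: N.indep_var_distribution_eq)
  \<comment> \<open>Equal distribution functions give equal laws, so \<open>D\<close> carries the
    finite mean of \<open>X\<close> over to \<open>X1\<close> and \<open>X2\<close>.\<close>
  have D1: "distr N borel X1 = D" and D2: "distr N borel X2 = D"
    using assms(4,9,10) D by (auto intro!: cdf_unique simp: dist_fun_def D_def)
  have "integrable D (\<lambda>x. x)"
    using assms(2,6) by (simp add: D_def integrable_distr_eq)
  then have "integrable N X1" "integrable N X2"
    using integrable_distr[OF X1, of "\<lambda>x. x"] integrable_distr[OF X2, of "\<lambda>x. x"]
    by (simp_all add: D1 D2)
  \<comment> \<open>By independence the product of \<open>D\<close> with itself is the joint law of
    \<open>X1\<close> and \<open>X2\<close>, so integrability is checked on \<open>N\<close>, where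
    \<bar>X1 - X2\<bar> inherits it from the two variables.\<close>
  then have "integrable (D \<Otimes>\<^sub>M D) (\<lambda>(x, y). \<bar>x - y\<bar>)"
    using joint by (simp add: D1 D2 integrable_distr_eq case_prod_beta)
  then have "2 * (LINT x | D. LINT y | D. max 0 (x - y)) = (LINT (x, y) | (D \<Otimes>\<^sub>M D). \<bar>x - y\<bar>)"
    using integral_pair_abs_diff[OF D] by simp
  also have "\<dots> = N.expectation (\<lambda>\<omega>. \<bar>X1 \<omega> - X2 \<omega>\<bar>)"
    using joint by (simp add: D1 D2 integral_distr case_prod_beta)
  finally show ?thesis
    using M.gen_cumulative_entropy_double[OF assms(2,3)] by (simp add: assms(4) D_def)
qed

end
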